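(* Let $A\in\mathbb{R}^{m\times n}$ be of full row rank, $b\in\mathbb{R}^m$, $0<s\le n$, $A_s=\{w\in\mathbb{R}^n:\|w\|_0\le s\}$, and $Q\in\{(AA^{\top})^{-1},I_m\}$, with $f_Q$ and $L_Q$ as in the context. Suppose there exists $\nu_s>0$ such that $$\nu_s\|w\|^2\le\|Aw\|^2,\quad\forall w\in A_s.$$ Then any sequence $\{w^k\}$ generated by $w^{k+1}\in T^\lambda_{\rm PDMC}(w^k)$ with $\lambda\in(0,1/L_Q]$ has an accumulation point $w^*\in\mathrm{Fix}(T^\lambda_{\rm PDMC})$, and full sequence convergence holds if $T^\lambda_{\rm PDMC}$ is single-valued at $w^*$. The same conclusion holds (with $T^\lambda_{\rm FB}$ in place of $T^\lambda_{\rm PDMC}$) for a sequence generated by $w^{k+1}\in T^\lambda_{\rm FB}(w^k)$ with stepsizes $\lambda\in(0,1/L_Q)$.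
   Context: This concerns the sparse affine feasibility problem: find $w\in S_1\cap S_2$ with $S_1=\{w\in\mathbb{R}^n: Aw=b\}$ and $S_2=A_s$, where $\|w\|_0$ is the number of nonzero entries of $w$. $\|\cdot\|$ is the Euclidean norm (operator norm for matrices). $\mathrm{Fix}(T)=\{w:w\in T(w)\}$. $P_{S_2}(w)=\arg\min_{z\in S_2}\|w-z\|$ is the (possibly set-valued) projector. $f_Q(w)=\frac12w^{\top}A^{\top}QAw-w^{\top}A^{\top}Qb+\frac12b^{\top}Qb$, with $\nabla f_Q(w)=A^{\top}Q(Aw-b)$; $L_Q=1$ if $Q=(AA^{\top})^{-1}$ and $L_Q=\|A\|^2$ if $Q=I_m$. The operators are $$T^\lambda_{\rm PDMC}(w)=\frac{1}{1+\lambda}\big(w-\lambda\nabla f_Q(w)+\lambda P_{S_2}(w)\big),$$ $$T^\lambda_{\rm FB}(w)=\frac{\lambda}{1+\lambda}P_{S_2}(w-\lambda\nabla f_Q(w))+\frac{1}{1+\lambda}(w-\lambda\nabla f_Q(w)).$$ *)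

theory Defs
  imports "HOL-Analysis.Analysis"
begin

definition l0_norm :: "real ^ 'n \<Rightarrow> nat" where
  "l0_norm w = card {i. w $ i \<noteq> 0}"

definition sparse_set :: "nat \<Rightarrow> (real ^ 'n) set" where
  "sparse_set s = {w. l0_norm w \<le> s}"

text \<open>The projector is set-valued: all nearest points are collected, in contrast to
  \<^const>\<open>closest_point\<close>, which selects one of them.\<close>

definition projector :: "'a::real_normed_vector set \<Rightarrow> 'a \<Rightarrow> 'a set" where
  "projector S w = {z. is_arg_min (\<lambda>z. norm (w - z)) (\<lambda>z. z \<in> S) z}"

definition gradient :: "('a::real_inner \<Rightarrow> real) \<Rightarrow> 'a \<Rightarrow> 'a" where
  "gradient f w = (THE g. GDERIV f w :> g)"

definition f_Q :: "real ^ 'n ^ 'm \<Rightarrow> real ^ 'm \<Rightarrow> real ^ 'm ^ 'm \<Rightarrow> real ^ 'n \<Rightarrow> real" where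
  "f_Q A b Q w =
     1/2 * (w \<bullet> ((transpose A ** Q ** A) *v w)) - w \<bullet> ((transpose A ** Q) *v b) + 1/2 * (b \<bullet> (Q *v b))"

text \<open>Only the two weights \<open>Q = (A A\<^sup>T)\<^sup>-\<^sup>1\<close> and \<open>Q = I\<close> are of interest. If they coincide,
  then \<open>A A\<^sup>T = I\<close>, so the operator norm of \<open>A\<close> is 1 and both branches agree.\<close>

definition L_Q :: "real ^ 'n ^ 'm \<Rightarrow> real ^ 'm ^ 'm \<Rightarrow> real" where
  "L_Q A Q = (if Q = matrix_inv (A ** transpose A) then 1 else (onorm ((*v) A))\<^sup>2)"

definition T_PDMC ::
  "real ^ 'n ^ 'm \<Rightarrow> real ^ 'm \<Rightarrow> real ^ 'm ^ 'm \<Rightarrow> nat \<Rightarrow> real \<Rightarrow> real ^ 'n \<Rightarrow> (real ^ 'n) set" where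
  "T_PDMC A b Q s lam w =
     (\<lambda>p. (1 / (1 + lam)) *\<^sub>R (w - lam *\<^sub>R gradient (f_Q A b Q) w + lam *\<^sub>R p)) ` projector (sparse_set s) w"

definition T_FB ::
  "real ^ 'n ^ 'm \<Rightarrow> real ^ 'm \<Rightarrow> real ^ 'm ^ 'm \<Rightarrow> nat \<Rightarrow> real \<Rightarrow> real ^ 'n \<Rightarrow> (real ^ 'n) set" where
  "T_FB A b Q s lam w =
     (\<lambda>p. (lam / (1 + lam)) *\<^sub>R p + (1 / (1 + lam)) *\<^sub>R (w - lam *\<^sub>R gradient (f_Q A b Q) w))
       ` projector (sparse_set s) (w - lam *\<^sub>R gradient (f_Q A b Q) w)"

definition Fix :: "('a \<Rightarrow> 'a set) \<Rightarrow> 'a set" where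
  "Fix T = {w. w \<in> T w}"

definition accumulation_point :: "(nat \<Rightarrow> 'a::topological_space) \<Rightarrow> 'a \<Rightarrow> bool" where
  "accumulation_point w x \<longleftrightarrow> (\<exists>r. strict_mono r \<and> (w \<circ> r) \<longlonglongrightarrow> x)"

lemma gradient_eqI:
  assumes "GDERIV f w :> g"
  shows "gradient f w = g"
  unfolding gradient_def
proof (rule the_equality)
  show "GDERIV f w :> g" by (fact assms)
next
  fix h assume "GDERIV f w :> h"
  then have "(\<lambda>x. inner x h) = (\<lambda>x. inner x g)"
    using assms has_derivative_unique unfolding gderiv_def by blast
  then show "h = g" by (metis vector_eq_rdot inner_commute)
qed

lemma gradient_f_Q:
  assumes "transpose Q = Q"
  shows "gradient (f_Q A b Q) w = transpose A *v (Q *v (A *v w - b))"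
proof (rule gradient_eqI)
  let ?M = "transpose A ** Q ** A"
  have sym: "x \<bullet> (?M *v y) = y \<bullet> (?M *v x)" for x y
  proof -
    have "transpose ?M = ?M"
      using assms by (simp add: matrix_transpose_mul matrix_mul_assoc)
    then show ?thesis by (metis dot_lmul_matrix inner_commute transpose_matrix_vector)
  qed
  have lin: "((*v) ?M has_derivative (*v) ?M) (at w)"
    by (simp add: bounded_linear_imp_has_derivative)
  have "(f_Q A b Q has_derivative
     (\<lambda>h. 1/2 * (w \<bullet> (?M *v h) + h \<bullet> (?M *v w)) - h \<bullet> ((transpose A ** Q) *v b))) (at w)"
    unfolding f_Q_def by (auto intro!: derivative_eq_intros lin)
  moreover have "(\<lambda>h. 1/2 * (w \<bullet> (?M *v h) + h \<bullet> (?M *v w)) - h \<bullet> ((transpose A ** Q) *v b))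
     = (\<lambda>h. h \<bullet> (transpose A *v (Q *v (A *v w - b))))"
    by (rule ext, subst sym)
      (simp add: matrix_vector_mul_assoc[symmetric] matrix_vector_mult_diff_distrib inner_diff_right)
  ultimately show "GDERIV (f_Q A b Q) w :> transpose A *v (Q *v (A *v w - b))"
    unfolding gderiv_def by simp
qed

end

theory Submission
  imports Defs
begin

text \<open>Both schemes decrease \<open>V = f\<^sub>Q + (infdist _ A\<^sub>s)\<^sup>2 / 2\<close> by a multiple of the squared step length:
  the PDMC step minimizes a majorizer of \<open>V\<close> in which the concave part of the squared distance is
  linearized, and the FB step is a proximal gradient step for \<open>V\<close>. The restricted lower bound on \<open>A\<close>
  makes \<open>V\<close> coercive, so the iterates are bounded with vanishing steps, and since the operators have
  closed graph every accumulation point is a fixed point. If the operator is single-valued at such a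
  point, then all coordinate subspaces active nearby project to the same point there; as the gradient
  step and these linear projections are nonexpansive, the distance to the fixed point is eventually
  nonincreasing, and the whole sequence converges.\<close>

section \<open>Set-valued projections and relaxed projection operators\<close>

text \<open>Turns the argmin condition into an equation between continuous functions of
  \<open>w\<close> and \<open>z\<close>, which passes to limits.\<close>

lemma mem_projector_iff_infdist:
  "z \<in> projector S w \<longleftrightarrow> z \<in> S \<and> norm (w - z) = infdist w S"
proof
  assume z: "z \<in> projector S w"
  then have zS: "z \<in> S" and le: "\<And>y. y \<in> S \<Longrightarrow> norm (w - z) \<le> norm (w - y)"
    by (auto simp: projector_def is_arg_min_linorder)
  have "dist w z \<le> infdist w S"
    unfolding infdist_notempty[of S w, OF ex_in_conv[THEN iffD1, OF exI, OF zS]]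
    using zS le by (intro cINF_greatest) (auto simp: dist_norm)
  then show "z \<in> S \<and> norm (w - z) = infdist w S"
    using zS infdist_le[OF zS, of w] by (simp add: dist_norm)
next
  assume "z \<in> S \<and> norm (w - z) = infdist w S"
  then show "z \<in> projector S w"
    using infdist_le[of _ S w] by (auto simp: projector_def is_arg_min_linorder dist_norm)
qed

text \<open>Common form of both operators: \<open>G\<close> is the gradient step in either case,
  while \<open>\<phi>\<close>, the point to be projected, is the identity for PDMC and
  \<open>G\<close> for FB.\<close>

definition relaxed_projection ::
  "'a::real_normed_vector set \<Rightarrow> real \<Rightarrow> ('a \<Rightarrow> 'a) \<Rightarrow> ('a \<Rightarrow> 'a) \<Rightarrow> 'a \<Rightarrow> 'a set" where
  "relaxed_projection S lam \<phi> G w =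
     (\<lambda>p. (1 / (1 + lam)) *\<^sub>R (G w + lam *\<^sub>R p)) ` projector S (\<phi> w)"

text \<open>As \<open>lam > 0\<close>, the update formula can be solved for the projected point, so
  convergence of \<open>X\<close> and \<open>Y\<close> forces convergence of the projections;
  closedness of \<open>S\<close> and continuity of the distance do the rest.\<close>

lemma relaxed_projection_closed_graph:
  fixes S :: "'a::real_normed_vector set"
  assumes lam: "lam > 0" and S: "closed S"
    and \<phi>: "continuous_on UNIV \<phi>" and G: "continuous_on UNIV G"
    and x: "X \<longlonglongrightarrow> x" and y: "Y \<longlonglongrightarrow> y"
    and mem: "\<And>k. Y k \<in> relaxed_projection S lam \<phi> G (X k)"
  shows "y \<in> relaxed_projection S lam \<phi> G x"
proof -
  define P where "P k = (1 / lam) *\<^sub>R ((1 + lam) *\<^sub>R Y k - G (X k))" for k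
  define p where "p = (1 / lam) *\<^sub>R ((1 + lam) *\<^sub>R y - G x)"
  have Gx: "(\<lambda>k. G (X k)) \<longlonglongrightarrow> G x" and \<phi>x: "(\<lambda>k. \<phi> (X k)) \<longlonglongrightarrow> \<phi> x"
    using continuous_on_tendsto_compose[OF G x] continuous_on_tendsto_compose[OF \<phi> x] by auto
  have P: "P \<longlonglongrightarrow> p"
    unfolding P_def p_def by (intro tendsto_intros y Gx)
  have PS: "P k \<in> projector S (\<phi> (X k))" for k
  proof -
    obtain q where q: "q \<in> projector S (\<phi> (X k))"
      and Y: "Y k = (1 / (1 + lam)) *\<^sub>R (G (X k) + lam *\<^sub>R q)"
      using mem[of k] by (auto simp: relaxed_projection_def)
    have "P k = q"
      using lam unfolding P_def Y by simp
    then show ?thesis using q by simp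
  qed
  have "p \<in> S"
    using closed_sequentially[OF S _ P] PS by (simp add: mem_projector_iff_infdist)
  moreover have "norm (\<phi> x - p) = infdist (\<phi> x) S"
  proof (rule LIMSEQ_unique)
    show "(\<lambda>k. norm (\<phi> (X k) - P k)) \<longlonglongrightarrow> norm (\<phi> x - p)"
      by (intro tendsto_intros \<phi>x P)
    show "(\<lambda>k. norm (\<phi> (X k) - P k)) \<longlonglongrightarrow> infdist (\<phi> x) S"
      using PS by (simp add: mem_projector_iff_infdist tendsto_infdist \<phi>x)
  qed
  ultimately have "p \<in> projector S (\<phi> x)"
    by (simp add: mem_projector_iff_infdist)
  moreover have "y = (1 / (1 + lam)) *\<^sub>R (G x + lam *\<^sub>R p)"
    using lam by (simp add: p_def)
  ultimately show ?thesis by (auto simp: relaxed_projection_def)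
qed

section \<open>Convergence of descending and of locally nonexpansive iterations\<close>

text \<open>The decrements of the bounded-below sequence \<open>V (w k)\<close>, and with them the
  step lengths, tend to zero. Along a convergent subsequence \<open>w (r k)\<close> and
  \<open>w (Suc (r k))\<close> then share their limit, and the closed graph applies.\<close>

lemma descent_accumulation_point:
  fixes w :: "nat \<Rightarrow> 'a::{real_normed_vector, heine_borel}" and V :: "'a \<Rightarrow> real"
  assumes c: "c > 0" and V: "\<And>x. V x \<ge> 0"
    and bdd: "\<And>r. bounded {x. V x \<le> r}"
    and descent: "\<And>k. V (w (Suc k)) \<le> V (w k) - c * (norm (w (Suc k) - w k))\<^sup>2"
    and step: "\<And>k. w (Suc k) \<in> T (w k)"
    and closed: "\<And>X Y x y. X \<longlonglongrightarrow> x \<Longrightarrow> Y \<longlonglongrightarrow> y \<Longrightarrow> (\<And>k. Y k \<in> T (X k)) \<Longrightarrow> y \<in> T x"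
  shows "\<exists>x. accumulation_point w x \<and> x \<in> Fix T"
proof -
  have dec: "decseq (\<lambda>k. V (w k))"
  proof (rule decseq_SucI)
    fix k show "V (w (Suc k)) \<le> V (w k)"
      using descent[of k] c by (smt (verit) mult_nonneg_nonneg zero_le_power2)
  qed
  then have "range w \<subseteq> {x. V x \<le> V (w 0)}"
    by (auto simp: decseq_def)
  then have "bounded (range w)"
    using bdd bounded_subset by blast
  then obtain x r where r: "strict_mono r" and x: "(w \<circ> r) \<longlonglongrightarrow> x"
    using bounded_imp_convergent_subsequence by blast
  obtain l where l: "(\<lambda>k. V (w k)) \<longlonglongrightarrow> l"
    using decseq_convergent[OF dec, of 0] V by blast
  have "(\<lambda>k. (V (w k) - V (w (Suc k))) / c) \<longlonglongrightarrow> (l - l) / c"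
    by (intro tendsto_intros l LIMSEQ_Suc) (use c in auto)
  then have lim: "(\<lambda>k. (V (w k) - V (w (Suc k))) / c) \<longlonglongrightarrow> 0" by simp
  have "(\<lambda>k. (norm (w (Suc k) - w k))\<^sup>2) \<longlonglongrightarrow> 0"
  proof (rule tendsto_sandwich[OF _ _ tendsto_const lim])
    show "\<forall>\<^sub>F k in sequentially. (norm (w (Suc k) - w k))\<^sup>2 \<le> (V (w k) - V (w (Suc k))) / c"
      using descent c by (intro always_eventually allI) (smt (verit) mult.commute pos_le_divide_eq)
  qed simp
  then have "(\<lambda>k. w (Suc k) - w k) \<longlonglongrightarrow> 0"
    by (simp add: tendsto_norm_zero_iff)
  then have "((\<lambda>k. w (Suc k) - w k) \<circ> r) \<longlonglongrightarrow> 0"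
    using r by (rule LIMSEQ_subseq_LIMSEQ)
  then have "(\<lambda>k. (w \<circ> r) k + (w (Suc (r k)) - w (r k))) \<longlonglongrightarrow> x + 0"
    by (intro tendsto_intros x) (simp add: o_def)
  then have "(\<lambda>k. w (Suc (r k))) \<longlonglongrightarrow> x" by simp
  then have "x \<in> T x"
    by (rule closed[OF x]) (simp add: step)
  then show ?thesis
    using r x by (auto simp: accumulation_point_def Fix_def)
qed

text \<open>Some iterate comes into a small ball around \<open>x\<close>, and no later iterate can
  leave that ball.\<close>

lemma locally_nonexpansive_convergent:
  fixes w :: "nat \<Rightarrow> 'a::real_normed_vector"
  assumes acc: "accumulation_point w x"
    and step: "\<And>k. w (Suc k) \<in> T (w k)"
    and \<delta>: "\<delta> > 0"
    and loc: "\<And>y z. norm (y - x) < \<delta> \<Longrightarrow> z \<in> T y \<Longrightarrow> norm (z - x) \<le> norm (y - x)"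
  shows "w \<longlonglongrightarrow> x"
proof (rule LIMSEQ_I)
  fix e :: real assume e: "e > 0"
  obtain r where "(w \<circ> r) \<longlonglongrightarrow> x"
    using acc by (auto simp: accumulation_point_def)
  \<comment> \<open>The radius uses \<open>e\<close> for the accuracy and \<open>\<delta>\<close> to
    keep \<open>loc\<close> applicable throughout the induction.\<close>
  then obtain k where "norm ((w \<circ> r) k - x) < min e \<delta>"
    using LIMSEQ_D[of "w \<circ> r" x "min e \<delta>"] e \<delta> by (metis min_less_iff_conj order_refl)
  then have k: "norm (w (r k) - x) < min e \<delta>" by simp
  have "norm (w n - x) < min e \<delta>" if "n \<ge> r k" for n
    using that
  proof (induction n rule: dec_induct)
    case (step n)
    have "norm (w (Suc n) - x) \<le> norm (w n - x)"
      by (rule loc[OF _ assms(2)]) (use step in simp)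
    then show ?case using step by simp
  qed (rule k)
  then show "\<exists>N. \<forall>n\<ge>N. norm (w n - x) < e" by auto
qed

section \<open>The sparse set as a finite union of coordinate subspaces\<close>

text \<open>Orthogonal projection onto the coordinate subspace with index set
  \<open>I\<close>.\<close>

definition restrict_vec :: "'n set \<Rightarrow> real ^ 'n \<Rightarrow> real ^ 'n" where
  "restrict_vec I w = (\<chi> i. if i \<in> I then w $ i else 0)"

lemma restrict_vec_diff: "restrict_vec I (v - w) = restrict_vec I v - restrict_vec I w"
  by (simp add: restrict_vec_def vec_eq_iff)

lemma norm_restrict_vec_le: "norm (restrict_vec I w) \<le> norm w"
  by (rule norm_le_componentwise_cart) (simp add: restrict_vec_def)

lemma continuous_on_restrict_vec [continuous_intros]: "continuous_on X (restrict_vec I)"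
  unfolding restrict_vec_def
proof (rule continuous_on_vec_lambda)
  fix i show "continuous_on X (\<lambda>w. if i \<in> I then w $ i else 0)"
    by (cases "i \<in> I") (auto intro!: continuous_intros)
qed

lemma restrict_vec_mem_sparse_set:
  assumes "card I \<le> s"
  shows "restrict_vec I w \<in> sparse_set s"
proof -
  have "card {i. restrict_vec I w $ i \<noteq> 0} \<le> card I"
    by (rule card_mono) (auto simp: restrict_vec_def)
  then show ?thesis
    using assms by (simp add: sparse_set_def l0_norm_def)
qed

text \<open>The support of \<open>w\<close> serves as \<open>I\<close>. The union is finite and its
  members are fixed-point sets of continuous maps, whence closedness.\<close>

lemma sparse_set_eq_Union:
  "sparse_set s = (\<Union>I\<in>{I. card I \<le> s}. {w. restrict_vec I w = w})"
proof (intro equalityI subsetI)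
  fix w :: "real ^ 'n" assume "w \<in> sparse_set s"
  then have "card {i. w $ i \<noteq> 0} \<le> s"
    by (simp add: sparse_set_def l0_norm_def)
  moreover have "restrict_vec {i. w $ i \<noteq> 0} w = w"
    by (simp add: restrict_vec_def vec_eq_iff)
  ultimately show "w \<in> (\<Union>I\<in>{I. card I \<le> s}. {w. restrict_vec I w = w})" by auto
next
  fix w :: "real ^ 'n" assume "w \<in> (\<Union>I\<in>{I. card I \<le> s}. {w. restrict_vec I w = w})"
  then obtain I where "card I \<le> s" "restrict_vec I w = w" by blast
  then show "w \<in> sparse_set s"
    using restrict_vec_mem_sparse_set[of I s w] by simp
qed

lemma closed_sparse_set: "closed (sparse_set s)"
  unfolding sparse_set_eq_Union
  by (rule closed_UN, rule finite)
    (auto intro!: closed_Collect_eq continuous_on_restrict_vec continuous_on_id)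

text \<open>By Pythagoras the restriction of \<open>y\<close> to \<open>I\<close> is the only vector
  supported in \<open>I\<close> that is nearest to \<open>y\<close>; being sparse itself, it
  competes with \<open>q\<close>.\<close>

lemma projector_sparse_set_support:
  assumes q: "q \<in> projector (sparse_set s) y"
  obtains I where "card I \<le> s" "q = restrict_vec I y"
proof -
  obtain I where I: "card I \<le> s" "restrict_vec I q = q"
    using q by (auto simp: mem_projector_iff_infdist sparse_set_eq_Union)
  have qz: "q $ i = 0" if "i \<notin> I" for i
    using I(2) that by (auto simp: restrict_vec_def vec_eq_iff dest: spec[of _ i])
  have "norm (y - q) \<le> norm (y - restrict_vec I y)"
    using q infdist_le[OF restrict_vec_mem_sparse_set[OF I(1)], of y y]
    by (simp add: mem_projector_iff_infdist dist_norm)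
  \<comment> \<open>Coordinatewise: on \<open>I\<close> the first residual on the right vanishes,
    off \<open>I\<close> the second one does.\<close>
  moreover have "(norm (y - q))\<^sup>2 = (norm (y - restrict_vec I y))\<^sup>2 + (norm (restrict_vec I y - q))\<^sup>2"
    unfolding power2_norm_eq_inner inner_vec_def restrict_vec_def
    by (simp add: sum.distrib[symmetric]) (rule sum.cong, auto simp: qz)
  ultimately have "(norm (restrict_vec I y - q))\<^sup>2 \<le> 0"
    by (smt (verit) norm_ge_zero power_mono)
  then have "q = restrict_vec I y" by simp
  then show ?thesis using I(1) that by blast
qed

text \<open>Only finitely many supports occur, and those that are not optimal at \<open>x\<close> stay non-optimal
  nearby; the remaining ones all project \<open>x\<close> to the same point \<open>p\<close>.\<close>

lemma projector_sparse_set_locally_nonexpansive: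
  fixes x :: "real ^ 'n"
  assumes p: "projector (sparse_set s) x = {p}"
  obtains \<delta> where "\<delta> > 0"
    and "\<And>y q. norm (y - x) < \<delta> \<Longrightarrow> q \<in> projector (sparse_set s) y \<Longrightarrow> norm (q - p) \<le> norm (y - x)"
proof -
  let ?S = "sparse_set s :: (real ^ 'n) set"
  have "\<forall>\<^sub>F y in nhds x. \<forall>I\<in>{I. card I \<le> s \<and> restrict_vec I x \<noteq> p}.
          infdist y ?S < norm (y - restrict_vec I y)"
  proof (intro eventually_ball_finite finite ballI)
    fix I assume "I \<in> {I. card I \<le> s \<and> restrict_vec I x \<noteq> p}"
    then have I: "card I \<le> s" "restrict_vec I x \<notin> projector ?S x"
      unfolding p by simp_all
    then have "infdist x ?S \<noteq> norm (x - restrict_vec I x)"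
      by (simp add: mem_projector_iff_infdist restrict_vec_mem_sparse_set)
    then have "infdist x ?S < norm (x - restrict_vec I x)"
      using infdist_le[OF restrict_vec_mem_sparse_set[OF I(1)], of x x] by (simp add: dist_norm)
    moreover have "open {y. infdist y ?S < norm (y - restrict_vec I y)}"
      by (intro open_Collect_less continuous_intros)
    ultimately show "\<forall>\<^sub>F y in nhds x. infdist y ?S < norm (y - restrict_vec I y)"
      using eventually_nhds_in_open by fastforce
  qed
  then obtain \<delta> where \<delta>: "\<delta> > 0"
    and D: "\<forall>y. dist y x < \<delta> \<longrightarrow> (\<forall>I\<in>{I. card I \<le> s \<and> restrict_vec I x \<noteq> p}.
          infdist y ?S < norm (y - restrict_vec I y))"
    unfolding eventually_nhds_metric by (elim exE conjE)
  show ?thesis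
  proof (rule that[OF \<delta>])
    fix y q assume y: "norm (y - x) < \<delta>" and q: "q \<in> projector ?S y"
    obtain I where I: "card I \<le> s" "q = restrict_vec I y"
      using q by (rule projector_sparse_set_support)
    \<comment> \<open>The support \<open>I\<close> attains the distance at \<open>y\<close>, so it
      is not among those excluded near \<open>x\<close>.\<close>
    have "dist y x < \<delta>" "\<not> infdist y ?S < norm (y - restrict_vec I y)"
      using y q I(2) by (simp_all add: mem_projector_iff_infdist dist_norm)
    then have "restrict_vec I x = p"
      using D I(1) by blast
    then have "q - p = restrict_vec I (y - x)"
      by (simp add: I(2) restrict_vec_diff)
    then show "norm (q - p) \<le> norm (y - x)"
      by (simp add: norm_restrict_vec_le)
  qed
qed

text \<open>An output is a convex combination of \<open>G y\<close> and a projection of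
  \<open>\<phi> y\<close>; near \<open>x\<close>, each is within \<open>norm (y - x)\<close> of its
  counterpart at \<open>x\<close>.\<close>

lemma relaxed_projection_sparse_set_locally_nonexpansive:
  fixes x :: "real ^ 'n"
  assumes lam: "lam > 0"
    and G: "\<And>y z. norm (G y - G z) \<le> norm (y - z)"
    and \<phi>: "\<And>y z. norm (\<phi> y - \<phi> z) \<le> norm (y - z)"
    and fixed: "x \<in> relaxed_projection (sparse_set s) lam \<phi> G x"
    and single: "is_singleton (relaxed_projection (sparse_set s) lam \<phi> G x)"
  obtains \<delta> where "\<delta> > 0"
    and "\<And>y z. norm (y - x) < \<delta> \<Longrightarrow> z \<in> relaxed_projection (sparse_set s) lam \<phi> G y \<Longrightarrow>
           norm (z - x) \<le> norm (y - x)"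
proof -
  let ?S = "sparse_set s :: (real ^ 'n) set"
  let ?h = "\<lambda>p. (1 / (1 + lam)) *\<^sub>R (G x + lam *\<^sub>R p)"
  have img: "?h ` projector ?S (\<phi> x) = {x}"
    using fixed single unfolding relaxed_projection_def is_singleton_def by (metis singletonD)
  then obtain p where p: "p \<in> projector ?S (\<phi> x)" and px: "?h p = x" by blast
  \<comment> \<open>The map \<open>?h\<close> is injective, so single-valuedness passes from the
    operator to the projector.\<close>
  have "q = p" if "q \<in> projector ?S (\<phi> x)" for q
  proof -
    have "?h q = ?h p"
      unfolding px using imageI[OF that, of ?h] img by simp
    then show ?thesis using lam by simp
  qed
  then have "projector ?S (\<phi> x) = {p}"
    using p by blast
  then obtain \<delta> where \<delta>: "\<delta> > 0"
    and D: "\<And>y q. norm (y - \<phi> x) < \<delta> \<Longrightarrow> q \<in> projector ?S y \<Longrightarrow> norm (q - p) \<le> norm (y - \<phi> x)"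
    by (rule projector_sparse_set_locally_nonexpansive) blast
  show ?thesis
  proof (rule that[OF \<delta>])
    fix y z assume y: "norm (y - x) < \<delta>" and z: "z \<in> relaxed_projection ?S lam \<phi> G y"
    obtain q where q: "q \<in> projector ?S (\<phi> y)" and zq: "z = (1 / (1 + lam)) *\<^sub>R (G y + lam *\<^sub>R q)"
      using z by (auto simp: relaxed_projection_def)
    have qp: "norm (q - p) \<le> norm (y - x)"
      using D[OF _ q] \<phi>[of y x] y by linarith
    have "z - x = (1 / (1 + lam)) *\<^sub>R ((G y - G x) + lam *\<^sub>R (q - p))"
      by (subst px[symmetric]) (simp add: zq algebra_simps)
    then have "norm (z - x) = norm ((G y - G x) + lam *\<^sub>R (q - p)) / (1 + lam)"
      using lam by simp
    also have "\<dots> \<le> (norm (y - x) + lam * norm (y - x)) / (1 + lam)"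
    proof (intro divide_right_mono order.trans[OF norm_triangle_ineq] add_mono G)
      show "norm (lam *\<^sub>R (q - p)) \<le> lam * norm (y - x)"
        using lam qp by simp
    qed (use lam in auto)
    also have "\<dots> = norm (y - x)"
      using lam by (simp add: field_simps)
    finally show "norm (z - x) \<le> norm (y - x)" .
  qed
qed

section \<open>Sufficient decrease of the two schemes\<close>

text \<open>The update minimizes the convex model
  \<open>g w \<bullet> (u - w) + \<bar>u - w\<bar>\<^sup>2 / (2 lam) + \<bar>u - p\<bar>\<^sup>2 / 2\<close>, which majorizes the objective increment.\<close>

lemma descent_PDMC:
  fixes w :: "'a::real_inner"
  assumes lam: "lam > 0" "lam * L \<le> 1"
    and smooth: "\<And>u w. f u \<le> f w + g w \<bullet> (u - w) + L / 2 * (norm (u - w))\<^sup>2"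
    and u: "u \<in> relaxed_projection S lam (\<lambda>w. w) (\<lambda>w. w - lam *\<^sub>R g w) w"
  shows "f u + (infdist u S)\<^sup>2 / 2
    \<le> f w + (infdist w S)\<^sup>2 / 2 - (1 + 1 / lam) / 2 * (norm (u - w))\<^sup>2"
proof -
  obtain p where pS: "p \<in> S" and pw: "infdist w S = norm (w - p)"
    and up: "u = (1 / (1 + lam)) *\<^sub>R (w - lam *\<^sub>R g w + lam *\<^sub>R p)"
    using u by (auto simp: relaxed_projection_def mem_projector_iff_infdist)
  define d where "d = u - w"
  have "(1 + lam) *\<^sub>R u = w - lam *\<^sub>R g w + lam *\<^sub>R p"
    using lam unfolding up by simp
  \<comment> \<open>Stationarity of the convex model at \<open>u\<close>.\<close>
  then have "lam *\<^sub>R g w = lam *\<^sub>R (p - u) - d"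
    by (simp add: d_def algebra_simps)
  then have "lam * (g w \<bullet> d) = lam * ((p - u) \<bullet> d) - d \<bullet> d"
    by (metis inner_diff_left inner_scaleR_left)
  then have gd: "g w \<bullet> d = (p - u) \<bullet> d - (norm d)\<^sup>2 / lam"
    using lam by (simp add: field_simps power2_norm_eq_inner)
  have wp: "(norm (w - p))\<^sup>2 = (norm (u - p))\<^sup>2 + 2 * ((p - u) \<bullet> d) + (norm d)\<^sup>2"
    by (simp add: d_def power2_norm_eq_inner inner_diff_left inner_diff_right inner_commute)
  \<comment> \<open>The distance to \<open>p\<close> majorizes the distance to \<open>S\<close>,
    with equality at \<open>w\<close>.\<close>
  have "(infdist u S)\<^sup>2 \<le> (norm (u - p))\<^sup>2"
    using infdist_le[OF pS, of u] by (simp add: dist_norm infdist_nonneg power_mono)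
  moreover have "L * (norm d)\<^sup>2 \<le> 1 / lam * (norm d)\<^sup>2"
    using lam by (intro mult_right_mono) (auto simp: field_simps)
  \<comment> \<open>The terms \<open>(p - u) \<bullet> d\<close> cancel; \<open>f\<close>
    contributes \<open>- 1 / lam + L / 2 \<le> - 1 / (2 * lam)\<close> and the distance
    \<open>- 1 / 2\<close>.\<close>
  ultimately show ?thesis
    using smooth[of u w] wp gd unfolding pw d_def[symmetric] by (simp add: field_simps)
qed

text \<open>The update is a proximal point of \<open>lam * (infdist _ S)\<^sup>2 / 2\<close> at \<open>w - lam *\<^sub>R g w\<close>.\<close>

lemma descent_FB:
  fixes w :: "'a::euclidean_space"
  assumes S: "closed S" "S \<noteq> {}"
    and lam: "lam > 0"
    and smooth: "\<And>u w. f u \<le> f w + g w \<bullet> (u - w) + L / 2 * (norm (u - w))\<^sup>2"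
    and u: "u \<in> relaxed_projection S lam (\<lambda>w. w - lam *\<^sub>R g w) (\<lambda>w. w - lam *\<^sub>R g w) w"
  shows "f u + (infdist u S)\<^sup>2 / 2
    \<le> f w + (infdist w S)\<^sup>2 / 2 - (1 / lam - L) / 2 * (norm (u - w))\<^sup>2"
proof -
  define z where "z = w - lam *\<^sub>R g w"
  obtain p where pS: "p \<in> S" and pz: "infdist z S = norm (z - p)"
    and up: "u = (1 / (1 + lam)) *\<^sub>R (z + lam *\<^sub>R p)"
    using u by (auto simp: relaxed_projection_def mem_projector_iff_infdist z_def)
  obtain q where qS: "q \<in> S" and qw: "infdist w S = norm (w - q)"
    using infdist_attains_inf[OF S, of w] by (auto simp: dist_norm)
  define d where "d = u - w"
  have u2: "(1 + lam) *\<^sub>R u = z + lam *\<^sub>R p"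
    using lam unfolding up by simp
  \<comment> \<open>The update divides the segment from \<open>z\<close> to \<open>p\<close> in the
    ratio \<open>lam : 1\<close>.\<close>
  have "(1 + lam) *\<^sub>R (u - z) = lam *\<^sub>R (p - z)" "(1 + lam) *\<^sub>R (u - p) = z - p"
    using u2 by (simp_all add: algebra_simps)
  then have "((1 + lam) * norm (u - z)) = lam * norm (z - p)" "(1 + lam) * norm (u - p) = norm (z - p)"
    using lam by (metis abs_of_pos add_pos_pos norm_scaleR norm_minus_commute zero_less_one)+
  then have n: "norm (u - z) = lam * norm (z - p) / (1 + lam)" "norm (u - p) = norm (z - p) / (1 + lam)"
    using lam by (auto simp: field_simps)
  have "(norm (u - z))\<^sup>2 / lam + (norm (u - p))\<^sup>2
      = (1 + lam) * (norm (z - p))\<^sup>2 / (1 + lam)\<^sup>2"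
  proof -
    have "(lam * norm (z - p) / (1 + lam))\<^sup>2 / lam = lam * (norm (z - p))\<^sup>2 / (1 + lam)\<^sup>2"
      using lam by (simp add: power_divide power_mult_distrib power2_eq_square)
    then show ?thesis
      unfolding n by (simp add: power_divide add_divide_distrib distrib_right add.commute)
  qed
  also have "\<dots> = (norm (z - p))\<^sup>2 / (1 + lam)"
    using lam by (simp add: power2_eq_square)
  also have "\<dots> \<le> (norm (z - q))\<^sup>2 / (1 + lam)"
    using lam infdist_le[OF qS, of z] by (intro divide_right_mono power_mono) (auto simp: pz dist_norm)
  also have "\<dots> \<le> (norm (z - w))\<^sup>2 / lam + (norm (w - q))\<^sup>2"
  proof -
    let ?a = "norm (z - w)" and ?b = "norm (w - q)"
    have "norm (z - q) \<le> ?a + ?b"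
      using norm_triangle_ineq[of "z - w" "w - q"] by simp
    then have "(norm (z - q))\<^sup>2 \<le> (?a + ?b)\<^sup>2" by (simp add: power_mono)
    then have "lam * (norm (z - q))\<^sup>2 \<le> lam * (?a + ?b)\<^sup>2" using lam by simp
    \<comment> \<open>With denominators cleared, the defect in the desired inequality is a perfect
      square.\<close>
    also have "\<dots> = (1 + lam) * (?a\<^sup>2 + lam * ?b\<^sup>2) - (?a - lam * ?b)\<^sup>2"
      by (simp add: power2_eq_square algebra_simps)
    also have "\<dots> \<le> (1 + lam) * (?a\<^sup>2 + lam * ?b\<^sup>2)" by simp
    finally show ?thesis using lam by (simp add: field_simps)
  qed
  finally have prox: "(norm (u - z))\<^sup>2 / lam + (norm (u - p))\<^sup>2 \<le> (norm (z - w))\<^sup>2 / lam + (norm (w - q))\<^sup>2" .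
  \<comment> \<open>Expanding around \<open>w\<close> brings in \<open>g w \<bullet> d\<close>; the
    terms in \<open>norm (z - w)\<close> then cancel in \<open>prox\<close>.\<close>
  have "u - z = d + lam *\<^sub>R g w" "z - w = - (lam *\<^sub>R g w)"
    by (simp_all add: d_def z_def)
  then have "(norm (u - z))\<^sup>2 = (norm d)\<^sup>2 + 2 * lam * (g w \<bullet> d) + (norm (z - w))\<^sup>2"
    by (simp add: power2_norm_eq_inner inner_add_left inner_add_right inner_commute
        del: norm_scaleR)
  then have "(norm (u - z))\<^sup>2 / lam = (norm d)\<^sup>2 / lam + 2 * (g w \<bullet> d) + (norm (z - w))\<^sup>2 / lam"
    using lam by (simp add: add_divide_distrib)
  moreover have "(infdist u S)\<^sup>2 \<le> (norm (u - p))\<^sup>2"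
    using infdist_le[OF pS, of u] by (simp add: dist_norm infdist_nonneg power_mono)
  ultimately show ?thesis
    using smooth[of u w] prox unfolding qw d_def[symmetric] by (simp add: field_simps)
qed

section \<open>The weighted least squares function and its gradient\<close>

declare transpose_matrix_vector [simp del]

text \<open>Adjointness in \<open>*v\<close> form; the simp rule disabled above would hide this
  pattern by rewriting to \<open>y v* A\<close>.\<close>

lemma inner_transpose_mult:
  fixes A :: "real ^ 'n ^ 'm"
  shows "x \<bullet> (transpose A *v y) = (A *v x) \<bullet> y"
  by (metis dot_lmul_matrix inner_commute transpose_matrix_vector)

lemma norm_matrix_vector_le:
  fixes A :: "real ^ 'n ^ 'm"
  shows "norm (A *v x) \<le> onorm ((*v) A) * norm x"
  by (rule onorm) simp

text \<open>Pair \<open>transpose A *v y\<close> with itself, move \<open>A\<close> across, apply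
  Cauchy-Schwarz and cancel one factor.\<close>

lemma norm_transpose_mult_le:
  fixes A :: "real ^ 'n ^ 'm"
  shows "norm (transpose A *v y) \<le> onorm ((*v) A) * norm y"
proof (cases "transpose A *v y = 0")
  case False
  let ?t = "transpose A *v y"
  have "norm ?t * norm ?t = (A *v ?t) \<bullet> y"
    by (metis inner_transpose_mult power2_eq_square power2_norm_eq_inner)
  also have "\<dots> \<le> norm (A *v ?t) * norm y"
    by (rule norm_cauchy_schwarz)
  also have "\<dots> \<le> onorm ((*v) A) * norm ?t * norm y"
    by (intro mult_right_mono norm_matrix_vector_le) simp
  finally have "norm ?t * norm ?t \<le> norm ?t * (onorm ((*v) A) * norm y)"
    by (simp add: mult_ac)
  then show ?thesis using False by simp
qed (simp add: onorm_pos_le)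

text \<open>Full row rank makes \<open>transpose A\<close> injective, and
  \<open>y \<bullet> (M *v y)\<close> is the squared norm of \<open>transpose A *v y\<close>, so
  \<open>M\<close> has trivial kernel. The inverse is symmetric because its transpose also inverts
  the symmetric \<open>M\<close>.\<close>

lemma gram_inverse:
  fixes A :: "real ^ 'n ^ 'm"
  assumes "rank A = CARD('m)"
  defines "M \<equiv> A ** transpose A"
  shows "M ** matrix_inv M = mat 1" "matrix_inv M ** M = mat 1"
    "transpose (matrix_inv M) = matrix_inv M"
proof -
  have injT: "inj ((*v) (transpose A))"
    using assms(1) by (simp add: full_rank_injective[symmetric] rank_transpose)
  have "y = 0" if "M *v y = 0" for y
  proof -
    have "(transpose A *v y) \<bullet> (transpose A *v y) = y \<bullet> (M *v y)"
      by (metis M_def inner_commute inner_transpose_mult matrix_vector_mul_assoc)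
    then have "transpose A *v y = 0" using that by simp
    then show ?thesis
      using injD[OF injT, of y 0] by simp
  qed
  then have "invertible M"
    by (metis invertible_left_inverse matrix_left_invertible_ker)
  then have "M ** matrix_inv M = mat 1 \<and> matrix_inv M ** M = mat 1"
    unfolding matrix_inv_def invertible_def by (rule someI_ex)
  then show r: "M ** matrix_inv M = mat 1" and l: "matrix_inv M ** M = mat 1" by auto
  have "transpose M = M"
    by (simp add: M_def matrix_transpose_mul)
  then have "transpose (matrix_inv M) ** M = mat 1"
    using r by (metis matrix_transpose_mul transpose_mat)
  then show "transpose (matrix_inv M) = matrix_inv M"
    using r by (metis matrix_mul_assoc matrix_mul_lid matrix_mul_rid)
qed

text \<open>For \<open>Q = (A A\<^sup>T)\<^sup>-\<^sup>1\<close> the Hessian \<open>A\<^sup>T Q A\<close> is an orthogonal projection.\<close>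

lemma weight_properties:
  fixes A :: "real ^ 'n ^ 'm" and Q :: "real ^ 'm ^ 'm"
  assumes rank: "rank A = CARD('m)"
    and Q: "Q \<in> {matrix_inv (A ** transpose A), mat 1}"
  shows "transpose Q = Q"
    and "\<exists>C\<ge>0. \<forall>y. (norm y)\<^sup>2 \<le> C * (y \<bullet> (Q *v y))"
    and "(norm (transpose A *v (Q *v (A *v v))))\<^sup>2 \<le> L_Q A Q * (v \<bullet> (transpose A *v (Q *v (A *v v))))"
proof -
  let ?K = "onorm ((*v) A)"
  note inv = gram_inverse[OF rank]
  show "transpose Q = Q"
    using Q inv(3) by auto
  show "\<exists>C\<ge>0. \<forall>y. (norm y)\<^sup>2 \<le> C * (y \<bullet> (Q *v y))"
  proof (cases "Q = mat 1")
    case True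
    then show ?thesis
      by (intro exI[of _ 1]) (simp add: power2_norm_eq_inner)
  next
    case False
    then have Qi: "Q = matrix_inv (A ** transpose A)" using Q by simp
    \<comment> \<open>\<open>y\<close> is the image under \<open>A\<close> of
      \<open>transpose A *v (Q *v y)\<close>, whose squared norm is
      \<open>y \<bullet> (Q *v y)\<close>.\<close>
    have "(norm y)\<^sup>2 \<le> ?K\<^sup>2 * (y \<bullet> (Q *v y))" for y
    proof -
      let ?u = "Q *v y"
      have y: "A *v (transpose A *v ?u) = y"
        unfolding Qi using inv(1) by (metis matrix_vector_mul_assoc matrix_vector_mul_lid)
      have "norm y \<le> ?K * norm (transpose A *v ?u)"
        using norm_matrix_vector_le[of A "transpose A *v ?u"] unfolding y .
      then have "(norm y)\<^sup>2 \<le> ?K\<^sup>2 * (norm (transpose A *v ?u))\<^sup>2"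
        by (metis norm_ge_zero power_mono power_mult_distrib)
      also have "(norm (transpose A *v ?u))\<^sup>2 = y \<bullet> ?u"
        by (simp add: power2_norm_eq_inner inner_transpose_mult y)
      finally show ?thesis .
    qed
    then show ?thesis by (intro exI[of _ "?K\<^sup>2"]) simp
  qed
  \<comment> \<open>The split mirrors the conditional in \<open>L_Q\<close>, so coinciding weights
    fall under the constant 1.\<close>
  show "(norm (transpose A *v (Q *v (A *v v))))\<^sup>2 \<le> L_Q A Q * (v \<bullet> (transpose A *v (Q *v (A *v v))))"
  proof (cases "Q = matrix_inv (A ** transpose A)")
    case True
    have "Q *v (A *v (transpose A *v (Q *v (A *v v)))) = Q *v (A *v v)"
      unfolding True using inv(1)
      by (metis matrix_vector_mul_assoc matrix_vector_mul_lid)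
    then have "(norm (transpose A *v (Q *v (A *v v))))\<^sup>2 = (A *v v) \<bullet> (Q *v (A *v v))"
      unfolding power2_norm_eq_inner inner_transpose_mult
      using inv(1) True by (metis matrix_vector_mul_assoc matrix_vector_mul_lid)
    then show ?thesis
      using True by (simp add: L_Q_def inner_transpose_mult)
  next
    case False
    then have "Q = mat 1" using Q by simp
    moreover have "(norm (transpose A *v (A *v v)))\<^sup>2 \<le> ?K\<^sup>2 * (norm (A *v v))\<^sup>2"
      by (metis norm_transpose_mult_le norm_ge_zero power_mono power_mult_distrib)
    ultimately show ?thesis
      using False by (simp add: L_Q_def inner_transpose_mult power2_norm_eq_inner)
  qed
qed

text \<open>Symmetry of \<open>Q\<close> merges the cross terms into a weighted square of the
  residual.\<close>

lemma f_Q_eq: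
  assumes "transpose Q = Q"
  shows "f_Q A b Q w = 1/2 * ((A *v w - b) \<bullet> (Q *v (A *v w - b)))"
proof -
  have "b \<bullet> (Q *v (A *v w)) = (A *v w) \<bullet> (Q *v b)"
    using inner_transpose_mult[of b Q "A *v w"] assms by (simp add: inner_commute)
  then show ?thesis
    unfolding f_Q_def
    by (simp add: matrix_vector_mul_assoc[symmetric] inner_transpose_mult
        matrix_vector_mult_diff_distrib inner_diff_left inner_diff_right algebra_simps)
qed

text \<open>Second-order Taylor formula, exact because \<open>f_Q\<close> is quadratic.\<close>

lemma f_Q_expansion:
  assumes "transpose Q = Q"
  shows "f_Q A b Q u = f_Q A b Q w + gradient (f_Q A b Q) w \<bullet> (u - w)
    + 1/2 * ((u - w) \<bullet> (transpose A *v (Q *v (A *v (u - w)))))"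
proof -
  define r where "r = A *v w - b"
  define d where "d = A *v (u - w)"
  have u: "A *v u - b = r + d"
    by (simp add: r_def d_def matrix_vector_mult_diff_distrib)
  have "r \<bullet> (Q *v d) = d \<bullet> (Q *v r)"
    using inner_transpose_mult[of r Q d] assms by (simp add: inner_commute)
  moreover have "gradient (f_Q A b Q) w \<bullet> (u - w) = d \<bullet> (Q *v r)"
    unfolding gradient_f_Q[OF assms] r_def d_def by (subst inner_commute) (rule inner_transpose_mult)
  ultimately show ?thesis
    unfolding f_Q_eq[OF assms, of A b u] f_Q_eq[OF assms, of A b w] u inner_transpose_mult
      r_def[symmetric] d_def[symmetric]
    by (simp add: matrix_vector_right_distrib inner_add_left inner_add_right)
qed

text \<open>Expanding \<open>norm (h - L *\<^sub>R v)\<close> squared and using cocoercivity bounds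
  the Hessian form \<open>v \<bullet> h\<close> by \<open>L\<close> times the squared norm of
  \<open>v\<close>.\<close>

lemma f_Q_smooth:
  fixes A :: "real ^ 'n ^ 'm"
  assumes sym: "transpose Q = Q"
    and L: "L > 0"
    and coco: "\<And>v. (norm (transpose A *v (Q *v (A *v v))))\<^sup>2 \<le> L * (v \<bullet> (transpose A *v (Q *v (A *v v))))"
  shows "f_Q A b Q u \<le> f_Q A b Q w + gradient (f_Q A b Q) w \<bullet> (u - w) + L / 2 * (norm (u - w))\<^sup>2"
proof -
  define v where "v = u - w"
  define h where "h = transpose A *v (Q *v (A *v v))"
  have t: "(norm h)\<^sup>2 \<le> L * (v \<bullet> h)" using coco[of v] by (simp add: h_def)
  have "0 \<le> (norm (h - L *\<^sub>R v))\<^sup>2" by simp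
  also have "\<dots> = (norm h)\<^sup>2 - 2 * L * (v \<bullet> h) + L * (L * (norm v)\<^sup>2)"
    by (simp add: power2_norm_eq_inner inner_diff_left inner_diff_right inner_commute del: norm_scaleR)
  also have "\<dots> \<le> L * (L * (norm v)\<^sup>2 - v \<bullet> h)"
    using t by (simp add: algebra_simps)
  finally have "v \<bullet> h \<le> L * (norm v)\<^sup>2"
    using L by (simp add: zero_le_mult_iff)
  then have "1/2 * (v \<bullet> h) \<le> L / 2 * (norm v)\<^sup>2" by simp
  then show ?thesis
    using f_Q_expansion[OF sym, of A b u w] unfolding v_def[symmetric] h_def[symmetric] by linarith
qed

text \<open>In the expanded square, cocoercivity and \<open>lam * L \<le> 1\<close> make the
  quadratic term at most half of the negative cross term.\<close>

lemma gradient_step_nonexpansive: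
  fixes A :: "real ^ 'n ^ 'm"
  assumes sym: "transpose Q = Q"
    and L: "L > 0" and lam: "lam > 0" "lam * L \<le> 1"
    and coco: "\<And>v. (norm (transpose A *v (Q *v (A *v v))))\<^sup>2 \<le> L * (v \<bullet> (transpose A *v (Q *v (A *v v))))"
  shows "norm ((u - lam *\<^sub>R gradient (f_Q A b Q) u) - (w - lam *\<^sub>R gradient (f_Q A b Q) w)) \<le> norm (u - w)"
proof -
  define v where "v = u - w"
  define h where "h = transpose A *v (Q *v (A *v v))"
  have t: "(norm h)\<^sup>2 \<le> L * (v \<bullet> h)" using coco[of v] by (simp add: h_def)
  then have "0 \<le> L * (v \<bullet> h)" by (rule order.trans[rotated]) simp
  then have pos: "v \<bullet> h \<ge> 0" using L by (simp add: zero_le_mult_iff)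
  have "(u - lam *\<^sub>R gradient (f_Q A b Q) u) - (w - lam *\<^sub>R gradient (f_Q A b Q) w) = v - lam *\<^sub>R h"
    unfolding gradient_f_Q[OF sym] v_def h_def
    by (simp add: matrix_vector_mult_diff_distrib scaleR_diff_right)
  moreover have "(norm (v - lam *\<^sub>R h))\<^sup>2 \<le> (norm v)\<^sup>2"
  proof -
    have "(norm (v - lam *\<^sub>R h))\<^sup>2 = (norm v)\<^sup>2 - 2 * lam * (v \<bullet> h) + lam * (lam * (norm h)\<^sup>2)"
      by (simp add: power2_norm_eq_inner inner_diff_left inner_diff_right inner_commute del: norm_scaleR)
    moreover have "lam * (lam * (norm h)\<^sup>2) \<le> lam * (v \<bullet> h)"
    proof (rule mult_left_mono)
      have "lam * (norm h)\<^sup>2 \<le> lam * (L * (v \<bullet> h))"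
        using t lam(1) by (intro mult_left_mono) auto
      also have "\<dots> = (lam * L) * (v \<bullet> h)" by simp
      also have "\<dots> \<le> 1 * (v \<bullet> h)"
        using lam(2) pos by (rule mult_right_mono)
      finally show "lam * (norm h)\<^sup>2 \<le> v \<bullet> h" by simp
    qed (use lam(1) in simp)
    moreover have "0 \<le> lam * (v \<bullet> h)"
      using lam(1) pos by simp
    ultimately show ?thesis by linarith
  qed
  ultimately show ?thesis
    unfolding v_def[symmetric] by (simp only: power2_le_imp_le norm_ge_zero)
qed

section \<open>Coercivity of the merit function\<close>

text \<open>Split \<open>w\<close> into a nearest sparse point \<open>p\<close> and a remainder. The
  distance term bounds the remainder and \<open>f_Q\<close> bounds the residual, hence
  \<open>A *v p\<close>; the restricted lower bound then controls \<open>p\<close>.\<close>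

lemma bounded_sublevel_f_Q_infdist_sparse_set:
  fixes A :: "real ^ 'n ^ 'm"
  assumes sym: "transpose Q = Q"
    and C: "C \<ge> 0" "\<And>y. (norm y)\<^sup>2 \<le> C * (y \<bullet> (Q *v y))"
    and Q0: "\<And>y. 0 \<le> y \<bullet> (Q *v y)"
    and \<nu>: "\<nu> > 0" "\<And>w. w \<in> sparse_set s \<Longrightarrow> \<nu> * (norm w)\<^sup>2 \<le> (norm (A *v w))\<^sup>2"
  shows "bounded {w. f_Q A b Q w + (infdist w (sparse_set s))\<^sup>2 / 2 \<le> r}"
proof (rule boundedI)
  let ?S = "sparse_set s :: (real ^ 'n) set" and ?K = "onorm ((*v) A)"
  fix w assume "w \<in> {w. f_Q A b Q w + (infdist w ?S)\<^sup>2 / 2 \<le> r}"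
  then have r: "(A *v w - b) \<bullet> (Q *v (A *v w - b)) + (infdist w ?S)\<^sup>2 \<le> 2 * r"
    by (simp add: f_Q_eq[OF sym])
  have "0 \<in> ?S" by (simp add: sparse_set_def l0_norm_def)
  then obtain p where p: "p \<in> ?S" and wp: "infdist w ?S = norm (w - p)"
    using infdist_attains_inf[OF closed_sparse_set[of s], of w] by (auto simp: dist_norm)
  have "(norm (w - p))\<^sup>2 \<le> 2 * r"
    using r Q0[of "A *v w - b"] unfolding wp by linarith
  then have d: "norm (w - p) \<le> sqrt (2 * r)" by (rule real_le_rsqrt)
  have "(A *v w - b) \<bullet> (Q *v (A *v w - b)) \<le> 2 * r"
    using r by (smt (verit) zero_le_power2)
  then have "(norm (A *v w - b))\<^sup>2 \<le> C * (2 * r)"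
    using C(1) C(2)[of "A *v w - b"] by (meson mult_left_mono order_trans)
  then have res: "norm (A *v w - b) \<le> sqrt (C * (2 * r))" by (rule real_le_rsqrt)
  have "A *v p = (A *v w - b) + b - A *v (w - p)"
    by (simp add: matrix_vector_mult_diff_distrib)
  then have "norm (A *v p) = norm ((A *v w - b) + b - A *v (w - p))"
    by (rule arg_cong)
  then have "norm (A *v p) \<le> norm (A *v w - b) + norm b + norm (A *v (w - p))"
    using norm_triangle_ineq4[of "(A *v w - b) + b" "A *v (w - p)"]
      norm_triangle_ineq[of "A *v w - b" b] by linarith
  also have "\<dots> \<le> sqrt (C * (2 * r)) + norm b + ?K * sqrt (2 * r)"
  proof (intro add_mono order_refl res)
    have "?K * norm (w - p) \<le> ?K * sqrt (2 * r)"
      by (intro mult_left_mono d onorm_pos_le matrix_vector_mul_bounded_linear)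
    then show "norm (A *v (w - p)) \<le> ?K * sqrt (2 * r)"
      using norm_matrix_vector_le[of A "w - p"] by linarith
  qed
  finally have Ap: "norm (A *v p) \<le> sqrt (C * (2 * r)) + norm b + ?K * sqrt (2 * r)" (is "_ \<le> ?M") .
  have "(sqrt \<nu> * norm p)\<^sup>2 \<le> (norm (A *v p))\<^sup>2"
    using \<nu>(1) \<nu>(2)[OF p] by (simp add: power_mult_distrib)
  then have "sqrt \<nu> * norm p \<le> norm (A *v p)"
    by (rule power2_le_imp_le) simp
  then have "norm p \<le> ?M / sqrt \<nu>"
    using Ap \<nu>(1) by (simp add: field_simps)
  moreover have "norm w \<le> norm (w - p) + norm p"
    using norm_triangle_ineq[of "w - p" p] by simp
  ultimately show "norm w \<le> sqrt (2 * r) + ?M / sqrt \<nu>"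
    using d by linarith
qed

section \<open>Application to the two schemes\<close>

lemma T_PDMC_eq:
  "T_PDMC A b Q s lam = relaxed_projection (sparse_set s) lam (\<lambda>w. w)
     (\<lambda>w. w - lam *\<^sub>R gradient (f_Q A b Q) w)"
  by (simp add: T_PDMC_def relaxed_projection_def fun_eq_iff)

lemma T_FB_eq:
  "T_FB A b Q s lam = relaxed_projection (sparse_set s) lam
     (\<lambda>w. w - lam *\<^sub>R gradient (f_Q A b Q) w) (\<lambda>w. w - lam *\<^sub>R gradient (f_Q A b Q) w)"
  by (simp add: T_FB_def relaxed_projection_def fun_eq_iff scaleR_add_right add.commute)

text \<open>Nonexpansiveness of \<open>G\<close> and \<open>\<phi>\<close> serves twice: as
  continuity for the closed graph, and for the local estimate near a fixed point.\<close>

lemma relaxed_projection_iteration_converges: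
  fixes A :: "real ^ 'n ^ 'm" and Q :: "real ^ 'm ^ 'm" and \<phi> :: "real ^ 'n \<Rightarrow> real ^ 'n"
  assumes rank: "rank A = CARD('m)"
    and Q: "Q \<in> {matrix_inv (A ** transpose A), mat 1}"
    and restricted: "\<exists>\<nu>>0. \<forall>w \<in> sparse_set s. \<nu> * (norm w)\<^sup>2 \<le> (norm (A *v w))\<^sup>2"
    and lam: "lam > 0" and G: "\<And>u w. norm (G u - G w) \<le> norm (u - w)"
    and \<phi>: "\<And>u w. norm (\<phi> u - \<phi> w) \<le> norm (u - w)"
    and c: "c > 0"
    and descent: "\<And>u w. u \<in> relaxed_projection (sparse_set s) lam \<phi> G w \<Longrightarrow>
      f_Q A b Q u + (infdist u (sparse_set s))\<^sup>2 / 2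
      \<le> f_Q A b Q w + (infdist w (sparse_set s))\<^sup>2 / 2 - c * (norm (u - w))\<^sup>2"
    and step: "\<And>k. w (Suc k) \<in> relaxed_projection (sparse_set s) lam \<phi> G (w k)"
  defines "T \<equiv> relaxed_projection (sparse_set s) lam \<phi> G"
  shows "(\<exists>x. accumulation_point w x \<and> x \<in> Fix T) \<and>
    (\<forall>x. accumulation_point w x \<and> x \<in> Fix T \<and> is_singleton (T x) \<longrightarrow> w \<longlonglongrightarrow> x)"
proof (intro conjI allI impI)
  note sym = weight_properties(1)[OF rank Q]
  obtain C where C: "C \<ge> 0" "\<And>y. (norm y)\<^sup>2 \<le> C * (y \<bullet> (Q *v y))"
    using weight_properties(2)[OF rank Q] by blast
  \<comment> \<open>A negative or zero form at \<open>y \<noteq> 0\<close> would contradict the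
    lower bound, since \<open>C \<ge> 0\<close>.\<close>
  have Q0: "0 \<le> y \<bullet> (Q *v y)" for y
  proof (cases "y = 0")
    case False
    then have "0 < C * (y \<bullet> (Q *v y))"
      using C(2)[of y] by (smt (verit) zero_less_power zero_less_norm_iff)
    then show ?thesis using C(1) by (simp add: zero_less_mult_iff)
  qed simp
  obtain \<nu> where \<nu>: "\<nu> > 0" "\<And>w. w \<in> sparse_set s \<Longrightarrow> \<nu> * (norm w)\<^sup>2 \<le> (norm (A *v w))\<^sup>2"
    using restricted by blast
  have cont: "continuous_on UNIV h" if "\<And>u w. norm (h u - h w) \<le> norm (u - w)" for h :: "real ^ 'n \<Rightarrow> real ^ 'n"
    unfolding continuous_on_iff dist_norm using that order.strict_trans1 by blast
  show "\<exists>x. accumulation_point w x \<and> x \<in> Fix T"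
  proof (rule descent_accumulation_point[OF c])
    show "0 \<le> f_Q A b Q x + (infdist x (sparse_set s))\<^sup>2 / 2" for x
      by (simp add: f_Q_eq[OF sym] Q0)
    show "bounded {x. f_Q A b Q x + (infdist x (sparse_set s))\<^sup>2 / 2 \<le> r}" for r
      by (rule bounded_sublevel_f_Q_infdist_sparse_set[OF sym C Q0 \<nu>])
    show "w (Suc k) \<in> T (w k)" for k
      unfolding T_def by (rule step)
    show "f_Q A b Q (w (Suc k)) + (infdist (w (Suc k)) (sparse_set s))\<^sup>2 / 2
      \<le> f_Q A b Q (w k) + (infdist (w k) (sparse_set s))\<^sup>2 / 2 - c * (norm (w (Suc k) - w k))\<^sup>2" for k
      by (rule descent[OF step])
    show "y \<in> T x" if "X \<longlonglongrightarrow> x" "Y \<longlonglongrightarrow> y" "\<And>k. Y k \<in> T (X k)" for X Y x y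
      using relaxed_projection_closed_graph[OF lam closed_sparse_set cont[OF \<phi>] cont[OF G]] that
      unfolding T_def by blast
  qed
next
  fix x assume x: "accumulation_point w x \<and> x \<in> Fix T \<and> is_singleton (T x)"
  then have "x \<in> T x" "is_singleton (T x)" by (auto simp: Fix_def)
  then obtain \<delta> where "\<delta> > 0"
    and "\<And>y z. norm (y - x) < \<delta> \<Longrightarrow> z \<in> T y \<Longrightarrow> norm (z - x) \<le> norm (y - x)"
    unfolding T_def
    by (rule relaxed_projection_sparse_set_locally_nonexpansive[OF lam G \<phi>]) blast
  then show "w \<longlonglongrightarrow> x"
    using x step locally_nonexpansive_convergent[of w x T \<delta>] unfolding T_def by blast
qed

theorem theorem6p3:
  fixes A :: "real ^ 'n ^ 'm" and b :: "real ^ 'm" and Q :: "real ^ 'm ^ 'm" and s :: nat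
  assumes full_row_rank: "rank A = CARD('m)"
    and s: "0 < s" "s \<le> CARD('n)"
    and Q: "Q \<in> {matrix_inv (A ** transpose A), mat 1}"
    and restricted: "\<exists>\<nu>>0. \<forall>w \<in> sparse_set s. \<nu> * (norm w)\<^sup>2 \<le> (norm (A *v w))\<^sup>2"
  shows
    "(\<forall>lam w. lam \<in> {0<..1 / L_Q A Q} \<and> (\<forall>k. w (Suc k) \<in> T_PDMC A b Q s lam (w k)) \<longrightarrow>
        (\<exists>x. accumulation_point w x \<and> x \<in> Fix (T_PDMC A b Q s lam)) \<and>
        (\<forall>x. accumulation_point w x \<and> x \<in> Fix (T_PDMC A b Q s lam) \<and>
             is_singleton (T_PDMC A b Q s lam x) \<longrightarrow> w \<longlonglongrightarrow> x)) \<and>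
     (\<forall>lam w. lam \<in> {0<..<1 / L_Q A Q} \<and> (\<forall>k. w (Suc k) \<in> T_FB A b Q s lam (w k)) \<longrightarrow>
        (\<exists>x. accumulation_point w x \<and> x \<in> Fix (T_FB A b Q s lam)) \<and>
        (\<forall>x. accumulation_point w x \<and> x \<in> Fix (T_FB A b Q s lam) \<and>
             is_singleton (T_FB A b Q s lam x) \<longrightarrow> w \<longlonglongrightarrow> x))"
proof -
  note coco = weight_properties(3)[OF full_row_rank Q]
  note sym = weight_properties(1)[OF full_row_rank Q]
  \<comment> \<open>As \<open>1 / 0 = 0\<close>, an admissible stepsize exists only if
    \<open>L_Q A Q\<close> is positive.\<close>
  have L: "L_Q A Q > 0" if "lam > 0" "lam \<le> 1 / L_Q A Q" for lam
    using that by (smt (verit) zero_less_divide_1_iff)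
  have nonempty: "(sparse_set s :: (real ^ 'n) set) \<noteq> {}"
    using restrict_vec_mem_sparse_set[of "{}"] by force
  show ?thesis
  proof (rule conjI; intro allI impI; elim conjE)
    fix lam and w :: "nat \<Rightarrow> real ^ 'n"
    assume "lam \<in> {0<..1 / L_Q A Q}" and step: "\<forall>k. w (Suc k) \<in> T_PDMC A b Q s lam (w k)"
    then have lam: "lam > 0" "lam \<le> 1 / L_Q A Q" by auto
    have lamL: "lam * L_Q A Q \<le> 1"
      using lam L[OF lam] by (simp add: field_simps)
    show "(\<exists>x. accumulation_point w x \<and> x \<in> Fix (T_PDMC A b Q s lam)) \<and>
      (\<forall>x. accumulation_point w x \<and> x \<in> Fix (T_PDMC A b Q s lam) \<and>
           is_singleton (T_PDMC A b Q s lam x) \<longrightarrow> w \<longlonglongrightarrow> x)"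
      unfolding T_PDMC_eq
    proof (rule relaxed_projection_iteration_converges[OF full_row_rank Q restricted lam(1) _ _ _ descent_PDMC])
      show "0 < (1 + 1 / lam) / 2" using lam(1) by (simp add: add_pos_pos)
    qed (use lam(1) lamL step gradient_step_nonexpansive[OF sym L[OF lam] lam(1) lamL coco]
          f_Q_smooth[OF sym L[OF lam] coco] in \<open>simp_all add: T_PDMC_eq\<close>)
  next
    fix lam and w :: "nat \<Rightarrow> real ^ 'n"
    assume "lam \<in> {0<..<1 / L_Q A Q}" and step: "\<forall>k. w (Suc k) \<in> T_FB A b Q s lam (w k)"
    then have lam: "lam > 0" "lam \<le> 1 / L_Q A Q" and less: "lam < 1 / L_Q A Q" by auto
    have lamL: "lam * L_Q A Q \<le> 1"
      using lam L[OF lam] by (simp add: field_simps)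
    show "(\<exists>x. accumulation_point w x \<and> x \<in> Fix (T_FB A b Q s lam)) \<and>
      (\<forall>x. accumulation_point w x \<and> x \<in> Fix (T_FB A b Q s lam) \<and>
           is_singleton (T_FB A b Q s lam x) \<longrightarrow> w \<longlonglongrightarrow> x)"
      unfolding T_FB_eq
    proof (rule relaxed_projection_iteration_converges[OF full_row_rank Q restricted lam(1) _ _ _
          descent_FB[OF closed_sparse_set nonempty]])
      \<comment> \<open>Here the strict stepsize bound enters.\<close>
      show "0 < (1 / lam - L_Q A Q) / 2"
        using less lam(1) L[OF lam] by (simp add: field_simps)
    qed (use lam(1) step gradient_step_nonexpansive[OF sym L[OF lam] lam(1) lamL coco]
          f_Q_smooth[OF sym L[OF lam] coco] in \<open>simp_all add: T_FB_eq\<close>)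
  qed
qed

end
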